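(* Let $G=(V,E)$ be a finite simple directed graph with $n$ nodes and let $v_l\in V$ be a node (the single leader, so $V_\ell=\{v_l\}$) such that $d(v_i,v_l)<\infty$ for all $v_i\in V$. Then $$\delta(G,V_\ell)<n \;\Longrightarrow\; \delta(G,V_\ell)>\zeta(G,V_\ell).$$
   Context: Graphs. $G=(V,E)$ is a finite simple directed graph (no self-loops, no multiple edges); $e_{ij}$ denotes an edge from $v_i$ to $v_j$. A node $v_j$ is an in-neighbor of $v_i$ if there is an edge from $v_j$ to $v_i$. The distance $d(u,v)\in\{0,1,2,\dots\}\cup\{\infty\}$ is the number of edges on a shortest directed path from $u$ to $v$, with $d(v,v)=0$ and $d(u,v)=\infty$ if there is no path from $u$ to $v$. Distance-based quantity $\delta(G,V_\ell)$. For a leader set $V_\ell=\{\ell_1,\dots,\ell_m\}\subseteq V$, the distance-to-leaders (DL) vector of a node $v\in V$ is $(d(v,\ell_1),\dots,d(v,\ell_m))$. A finite sequence $(\mathcal D_1,\dots,\mathcal D_k)$ of DL vectors of nodes of $G$ is pseudo-monotonically increasing (PMI) if for every $i$ there exists $\pi(i)\in\{1,\dots,m\}$ such that $[\mathcal D_i]_{\pi(i)}<[\mathcal D_j]_{\pi(i)}$ for all $j>i$ (here every finite number is $<\infty$, and $\infty<\infty$ is false; for the last vector the condition is vacuous). $\delta(G,V_\ell)$ is the length of a longest PMI sequence all of whose members are DL vectors of nodes of $G$ having at least one finite entry. Zero-forcing quantity $\zeta(G,V_\ell)$. Color the nodes of $V_\ell$ black and all other nodes white. Zero forcing rule: if a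 black node $v$ has exactly one white in-neighbor $u$, then $u$ is recolored black. The rule is applied repeatedly until no further color change is possible; the resulting set of black nodes is uniquely determined and is called the derived set $\mathrm{dset}(G,V_\ell)$. Define $\zeta(G,V_\ell)=|\mathrm{dset}(G,V_\ell)|$. *)

theory Defs
  imports "Graph_Theory.Graph_Theory" "HOL-Library.Extended_Nat" "HOL-Library.FuncSet"
begin

section \<open>Distances and pseudo-monotonically increasing sequences\<close>

text \<open>
  Graphs are the \<^locale>\<open>digraph\<close>s of the library: finite, loop-free, without multiple arcs.
  The infimum over the empty set is \<^term>\<open>\<infinity> :: enat\<close>, which covers the case that there is no
  path. The lemma \<open>ereal_digraph_dist\<close> below relates this to the library's weighted distance.
\<close>

definition digraph_dist :: "('a, 'b) pre_digraph \<Rightarrow> 'a \<Rightarrow> 'a \<Rightarrow> enat" where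
  "digraph_dist G u v = (INF p\<in>{p. pre_digraph.apath G u p v}. enat (length p))"

text \<open>
  Vectors are indexed by the leaders themselves instead of by an enumeration of the leader set;
  outside the leader set a vector has the dummy value \<^term>\<open>undefined\<close>.
\<close>

definition dl_vector :: "('a, 'b) pre_digraph \<Rightarrow> 'a set \<Rightarrow> 'a \<Rightarrow> ('a \<Rightarrow> enat)" where
  "dl_vector G L v = (\<lambda>l\<in>L. digraph_dist G v l)"

definition PMI :: "'a set \<Rightarrow> ('a \<Rightarrow> enat) list \<Rightarrow> bool" where
  "PMI L Ds \<longleftrightarrow>
     (\<forall>i<length Ds. \<exists>l\<in>L. \<forall>j. i < j \<and> j < length Ds \<longrightarrow> (Ds ! i) l < (Ds ! j) l)"

definition PMI_seqs :: "('a, 'b) pre_digraph \<Rightarrow> 'a set \<Rightarrow> ('a \<Rightarrow> enat) list set" where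
  "PMI_seqs G L =
     {Ds. PMI L Ds \<and> (\<forall>D\<in>set Ds. D \<in> dl_vector G L ` verts G \<and> (\<exists>l\<in>L. D l < \<infinity>))}"

definition pmi_delta :: "('a, 'b) pre_digraph \<Rightarrow> 'a set \<Rightarrow> nat" where
  "pmi_delta G L = Max (length ` PMI_seqs G L)"


section \<open>Zero forcing\<close>

text \<open>
  A single colour change; \<open>B\<close> and \<open>B'\<close> are the sets of black nodes before and after it.
\<close>

definition zf_step :: "('a, 'b) pre_digraph \<Rightarrow> 'a set \<Rightarrow> 'a set \<Rightarrow> bool" where
  "zf_step G B B' \<longleftrightarrow>
     (\<exists>v\<in>B. \<exists>u. {w. w \<rightarrow>\<^bsub>G\<^esub> v \<and> w \<notin> B} = {u} \<and> B' = insert u B)"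

definition is_dset :: "('a, 'b) pre_digraph \<Rightarrow> 'a set \<Rightarrow> 'a set \<Rightarrow> bool" where
  "is_dset G L B \<longleftrightarrow> (zf_step G)\<^sup>*\<^sup>* L B \<and> (\<nexists>B'. zf_step G B B')"

definition dset :: "('a, 'b) pre_digraph \<Rightarrow> 'a set \<Rightarrow> 'a set" where
  "dset G L = (THE B. is_dset G L B)"

definition zf_zeta :: "('a, 'b) pre_digraph \<Rightarrow> 'a set \<Rightarrow> nat" where
  "zf_zeta G L = card (dset G L)"


section \<open>The definitions are meaningful\<close>

lemma (in fin_digraph) ereal_digraph_dist:
  "ereal_of_enat (digraph_dist G u v) = \<mu> (\<lambda>_. 1) u v"
proof (cases "u \<rightarrow>\<^sup>* v")
  case False
  then have "{p. apath u p v} = {}"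
    by (auto simp: apath_def reachable_awalk)
  then show ?thesis
    using shortest_path_inf[OF False] by (simp add: digraph_dist_def top_enat_def)
next
  case True
  have cost: "awalk_cost (\<lambda>_. 1) p = real (length p)" for p :: "'b list"
    by (induct p) auto
  obtain p where p: "apath u p v" "\<mu> (\<lambda>_. 1) u v = awalk_cost (\<lambda>_. 1) p"
    using no_neg_cyc_reach_imp_path[OF True, of "\<lambda>_. 1"] by (auto simp: cost)
  have "digraph_dist G u v = enat (length p)"
    unfolding digraph_dist_def
  proof (rule antisym)
    show "(INF p\<in>{p. apath u p v}. enat (length p)) \<le> enat (length p)"
      using p(1) by (auto intro: INF_lower)
    show "enat (length p) \<le> (INF p\<in>{p. apath u p v}. enat (length p))"
    proof (rule INF_greatest)
      fix q assume "q \<in> {p. apath u p v}"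
      then have "ereal (real (length p)) \<le> ereal (real (length q))"
        using min_cost_le_walk_cost[of u q v "\<lambda>_. 1"] p(2) by (simp add: cost apath_def)
      then show "enat (length p) \<le> enat (length q)" by simp
    qed
  qed
  then show ?thesis using p(2) by (simp add: cost)
qed

lemma PMI_distinct:
  assumes "PMI L Ds"
  shows "distinct Ds"
  unfolding distinct_conv_nth
proof (intro allI impI)
  have less: "Ds ! i \<noteq> Ds ! j" if "i < j" "j < length Ds" for i j
    using assms that unfolding PMI_def by (metis less_irrefl less_trans)
  fix i j assume "i < length Ds" "j < length Ds" "i \<noteq> j"
  then show "Ds ! i \<noteq> Ds ! j"
    using less[of i j] less[of j i] by (metis linorder_neqE_nat)
qed

lemma (in fin_digraph) length_PMI_seqs:
  assumes "Ds \<in> PMI_seqs G L"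
  shows "length Ds \<le> card (verts G)"
proof -
  have "distinct Ds" "set Ds \<subseteq> dl_vector G L ` verts G"
    using assms PMI_distinct by (auto simp: PMI_seqs_def)
  then have "length Ds \<le> card (dl_vector G L ` verts G)"
    by (metis card_mono distinct_card finite_imageI finite_verts)
  also have "\<dots> \<le> card (verts G)" by (simp add: card_image_le)
  finally show ?thesis .
qed

lemma (in fin_digraph) PMI_lengths_finite_nonempty:
  "finite (length ` PMI_seqs G L)" "length ` PMI_seqs G L \<noteq> {}"
proof -
  have "length ` PMI_seqs G L \<subseteq> {..card (verts G)}"
    using length_PMI_seqs by auto
  then show "finite (length ` PMI_seqs G L)" by (rule finite_subset) simp
  have "[] \<in> PMI_seqs G L" by (simp add: PMI_seqs_def PMI_def)
  then show "length ` PMI_seqs G L \<noteq> {}" by blast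
qed

lemma is_dset_greatest:
  assumes "(zf_step G)\<^sup>*\<^sup>* L C" "is_dset G L B"
  shows "C \<subseteq> B"
  using assms(1)
proof (induction rule: rtranclp_induct)
  case base
  have "L \<subseteq> X" if "(zf_step G)\<^sup>*\<^sup>* L X" for X
    using that by (induction rule: rtranclp_induct) (auto simp: zf_step_def)
  then show ?case using assms(2) by (simp add: is_dset_def)
next
  case (step C C')
  then obtain v u where vu: "v \<in> C" "{w. w \<rightarrow>\<^bsub>G\<^esub> v \<and> w \<notin> C} = {u}" "C' = insert u C"
    by (auto simp: zf_step_def)
  have "u \<in> B"
  proof (rule ccontr)
    assume "u \<notin> B"
    with vu step.IH have "{w. w \<rightarrow>\<^bsub>G\<^esub> v \<and> w \<notin> B} = {u}" by blast
    then have "zf_step G B (insert u B)"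
      using vu(1) step.IH unfolding zf_step_def by blast
    then show False using assms(2) by (auto simp: is_dset_def)
  qed
  then show ?case using vu step.IH by simp
qed

lemma (in fin_digraph) ex1_is_dset:
  assumes "L \<subseteq> verts G"
  shows "\<exists>!B. is_dset G L B"
proof (rule ex_ex1I)
  show "\<exists>B. is_dset G L B"
    using assms
  proof (induction "card (verts G - L)" arbitrary: L rule: less_induct)
    case less
    show ?case
    proof (cases "\<exists>B'. zf_step G L B'")
      case False
      then show ?thesis by (auto simp: is_dset_def)
    next
      case True
      then obtain v u where vu: "v \<in> L" "{w. w \<rightarrow>\<^bsub>G\<^esub> v \<and> w \<notin> L} = {u}"
        and step: "zf_step G L (insert u L)"
        by (auto simp: zf_step_def)
      then have u: "u \<in> verts G" "u \<notin> L" by (auto dest: adj_in_verts)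
      then have "card (verts G - insert u L) < card (verts G - L)"
        by (intro psubset_card_mono) auto
      then obtain B where "is_dset G (insert u L) B"
        using less u by blast
      then show ?thesis
        using step unfolding is_dset_def by (metis converse_rtranclp_into_rtranclp)
    qed
  qed
  show "B = C" if "is_dset G L B" "is_dset G L C" for B C
    using that is_dset_greatest[of G L B C] is_dset_greatest[of G L C B]
    by (auto simp: is_dset_def)
qed

end

theory Submission
  imports Defs
begin

text \<open>
  With a single leader, a PMI sequence is a strictly increasing sequence of distances, so
  \<open>\<delta>\<close> is the number of distinct distances to the leader. If \<open>\<delta> < n\<close>, two nodes \<open>x \<noteq> y\<close> share a
  distance; let \<open>k\<close> be the least such distance. The nodes at distance less than \<open>k\<close> have pairwise
  distinct distances, and zero forcing never leaves this set: only a node at distance \<open>k - 1\<close> could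
  force a node outside, but there is just one such node, and both \<open>x\<close> and \<open>y\<close> are in-neighbours
  of it. Hence \<open>\<zeta>\<close> is at most the number of distances below \<open>k\<close>, whereas \<open>\<delta>\<close> also counts \<open>k\<close>.
\<close>

context fin_digraph
begin

text \<open>The infimum in \<open>digraph_dist\<close> ranges over paths, but an arc put in front of
  a path may only give a walk. Weighted distance with unit costs covers walks as well.\<close>

lemma digraph_dist_le_awalk:
  assumes "awalk u p v"
  shows "digraph_dist G u v \<le> enat (length p)"
proof -
  have cost: "awalk_cost (\<lambda>_. 1) p = real (length p)" for p :: "'b list"
    by (induct p) auto
  have "ereal_of_enat (digraph_dist G u v) \<le> ereal_of_enat (enat (length p))"
    using min_cost_le_walk_cost[OF assms, of "\<lambda>_. 1"] by (simp add: ereal_digraph_dist cost)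
  then show ?thesis by (simp only: ereal_of_enat_le_iff)
qed

lemma digraph_dist_attained:
  assumes "digraph_dist G u v = enat m"
  obtains p where "apath u p v" "length p = m"
proof -
  let ?P = "{p. apath u p v}"
  have "?P \<noteq> {}"
  proof
    assume "?P = {}"
    then have "digraph_dist G u v = \<infinity>" by (simp add: digraph_dist_def top_enat_def)
    with assms show False by simp
  qed
  \<comment> \<open>\<open>enat\<close> is well-ordered, so the infimum of a nonempty set is its
    least element.\<close>
  then have "(INF p\<in>?P. enat (length p)) \<in> (\<lambda>p. enat (length p)) ` ?P"
    unfolding Inf_enat_def by (auto intro: LeastI)
  then show ?thesis
    using assms that by (auto simp: digraph_dist_def)
qed

lemma digraph_dist_adj:
  assumes "u \<rightarrow> w"
  shows "digraph_dist G u v \<le> eSuc (digraph_dist G w v)"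
proof (cases "digraph_dist G w v")
  case (enat m)
  then obtain p where p: "apath w p v" "length p = m"
    by (rule digraph_dist_attained)
  obtain e where "e \<in> arcs G" "tail G e = u" "head G e = w"
    using assms by (auto simp: arcs_ends_def arc_to_ends_def)
  then have "awalk u (e # p) v"
    using p(1) by (auto simp: apath_def awalk_Cons_iff)
  from digraph_dist_le_awalk[OF this] show ?thesis
    using p(2) enat by (simp add: eSuc_enat)
qed simp

text \<open>Take the head of the first arc of a shortest path: the rest of the path bounds its
  distance above by \<open>m\<close>, and \<open>digraph_dist_adj\<close> bounds it below.\<close>

lemma digraph_dist_SucE:
  assumes "digraph_dist G u v = enat (Suc m)"
  obtains w where "u \<rightarrow> w" "digraph_dist G w v = enat m"
proof -
  obtain p where "apath u p v" "length p = Suc m"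
    using assms by (rule digraph_dist_attained)
  then obtain e q where e: "awalk u (e # q) v" "length q = m"
    by (cases p) (auto simp: apath_def)
  then have adj: "u \<rightarrow> head G e" and "awalk (head G e) q v"
    by (auto simp: awalk_Cons_iff intro: in_arcs_imp_in_arcs_ends)
  then have "digraph_dist G (head G e) v \<le> enat m"
    using digraph_dist_le_awalk e(2) by blast
  moreover have "enat (Suc m) \<le> eSuc (digraph_dist G (head G e) v)"
    using digraph_dist_adj[OF adj, of v] assms by simp
  ultimately have "digraph_dist G (head G e) v = enat m"
    by (cases "digraph_dist G (head G e) v") (auto simp: eSuc_enat)
  with adj show ?thesis by (rule that)
qed

text \<open>The distances to \<open>l\<close>, listed in increasing order, form a PMI
  sequence.\<close>

lemma card_distances_le_pmi_delta:
  assumes "\<forall>v\<in>verts G. digraph_dist G v l < \<infinity>"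
  shows "card ((\<lambda>v. digraph_dist G v l) ` verts G) \<le> pmi_delta G {l}"
proof -
  let ?A = "(\<lambda>v. digraph_dist G v l) ` verts G"
  let ?ds = "sorted_list_of_set ?A"
  let ?Ds = "map (\<lambda>d. \<lambda>x\<in>{l}. d) ?ds"
  have "PMI {l} ?Ds"
    using sorted_wrt_nth_less[OF strict_sorted_list_of_set, of _ _ ?A]
    by (auto simp: PMI_def)
  moreover have "(\<lambda>x\<in>{l}. digraph_dist G v l) = dl_vector G {l} v" for v
    by (auto simp: dl_vector_def)
  ultimately have "?Ds \<in> PMI_seqs G {l}"
    using assms by (auto simp: PMI_seqs_def dl_vector_def)
  then have "length ?Ds \<le> pmi_delta G {l}"
    unfolding pmi_delta_def by (intro Max_ge PMI_lengths_finite_nonempty imageI)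
  then show ?thesis by simp
qed

text \<open>Invariant principle: forcing steps lead from \<open>L\<close> to the derived set, so a
  set they cannot leave contains it.\<close>

lemma dset_subset:
  assumes "L \<subseteq> verts G" "L \<subseteq> S"
    and step: "\<And>B B'. B \<subseteq> S \<Longrightarrow> zf_step G B B' \<Longrightarrow> B' \<subseteq> S"
  shows "dset G L \<subseteq> S"
proof -
  have "is_dset G L (dset G L)"
    unfolding dset_def by (rule theI'[OF ex1_is_dset[OF assms(1)]])
  then have "(zf_step G)\<^sup>*\<^sup>* L (dset G L)" by (simp add: is_dset_def)
  then show ?thesis
    by (induction rule: rtranclp_induct) (use assms in blast)+
qed

lemma zf_zeta_less_card_distances:
  assumes l: "l \<in> verts G"
    and fin: "\<forall>v\<in>verts G. digraph_dist G v l < \<infinity>"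
    and not_inj: "\<not> inj_on (\<lambda>v. digraph_dist G v l) (verts G)"
  shows "zf_zeta G {l} < card ((\<lambda>v. digraph_dist G v l) ` verts G)"
proof -
  let ?d = "\<lambda>v. digraph_dist G v l"
  define P where "P k \<longleftrightarrow> (\<exists>x\<in>verts G. \<exists>y\<in>verts G. x \<noteq> y \<and> ?d x = k \<and> ?d y = k)" for k
  define k where "k = (LEAST k. P k)"
  have "\<exists>k. P k" using not_inj by (auto simp: P_def inj_on_def)
  then have "P k" unfolding k_def by (rule LeastI_ex)
  then obtain x y where xy: "x \<in> verts G" "y \<in> verts G" "x \<noteq> y" "?d x = k" "?d y = k"
    by (auto simp: P_def)
  define S where "S = {v \<in> verts G. ?d v < k}"
  \<comment> \<open>A collision in \<open>S\<close> would be at a distance below the least one,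
    \<open>k\<close>.\<close>
  have inj: "inj_on ?d S"
  proof (rule inj_onI)
    fix u v assume "u \<in> S" "v \<in> S" "?d u = ?d v"
    then show "u = v"
      using not_less_Least[of "?d u" P] by (auto simp: S_def k_def P_def)
  qed
  have d_l: "?d l = 0"
    using digraph_dist_le_awalk[of l "[]" l] l by (simp add: awalk_Nil_iff zero_enat_def[symmetric])
  have "l \<in> S"
  proof -
    \<comment> \<open>Only \<open>l\<close> has distance 0, so no two nodes share it.\<close>
    have "k \<noteq> 0"
    proof
      assume "k = 0"
      have "v = l" if "?d v = 0" for v
      proof -
        obtain p where "apath v p l" "length p = 0"
          using \<open>?d v = 0\<close> by (metis digraph_dist_attained zero_enat_def)
        then show ?thesis by (simp add: apath_Nil_iff)
      qed
      with xy \<open>k = 0\<close> show False by metis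
    qed
    then show ?thesis using l d_l by (simp add: S_def zero_less_iff_neq_zero)
  qed
  have "dset G {l} \<subseteq> S"
  proof (rule dset_subset)
    fix B B' assume B: "B \<subseteq> S" "zf_step G B B'"
    then obtain v w where v: "v \<in> B" and w: "{z. z \<rightarrow> v \<and> z \<notin> B} = {w}" "B' = insert w B"
      by (auto simp: zf_step_def)
    have "?d w < k"
    proof (rule ccontr)
      assume "\<not> ?d w < k"
      have "v \<in> S" using v B by blast
      then have "?d v < k" by (simp add: S_def)
      moreover have "?d w \<le> eSuc (?d v)"
        using w(1) by (intro digraph_dist_adj) blast
      \<comment> \<open>From \<open>?d v < k\<close> and \<open>k\<close> \<le> \<open>?d w\<close>
        \<le> \<open>eSuc (?d v)\<close>: the forcing node is at distance exactly
        \<open>k - 1\<close>.\<close>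
      ultimately have "k = eSuc (?d v)"
        using \<open>\<not> ?d w < k\<close> by (metis antisym ileI1 not_less order_trans)
      moreover obtain m where m: "?d v = enat m"
        using \<open>?d v < k\<close> by (cases "?d v") auto
      ultimately have k: "k = enat (Suc m)" by (simp add: eSuc_enat)
      \<comment> \<open>A shortest path from \<open>z\<close> continues at distance
        \<open>k - 1\<close>, where \<open>v\<close> is the only node. So \<open>z\<close> is a
        white in-neighbour of \<open>v\<close>, hence \<open>w\<close>; this cannot hold for both
        \<open>x\<close> and \<open>y\<close>.\<close>
      have "z = w" if z: "z \<in> verts G" "?d z = k" for z
      proof -
        obtain v' where v': "z \<rightarrow> v'" "?d v' = enat m"
          using z k by (metis digraph_dist_SucE)
        then have "v' \<in> S" using k by (auto simp: S_def dest: adj_in_verts)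
        then have "v' = v" using inj \<open>v \<in> S\<close> v' m by (simp add: inj_on_def)
        moreover have "z \<notin> B" using z B by (auto simp: S_def)
        ultimately show ?thesis using v' w(1) by blast
      qed
      then show False using xy by metis
    qed
    moreover have "w \<in> verts G" using w(1) by (auto dest: adj_in_verts)
    ultimately show "B' \<subseteq> S" using B w(2) by (simp add: S_def)
  qed (use l \<open>l \<in> S\<close> in auto)
  then have "zf_zeta G {l} \<le> card S"
    unfolding zf_zeta_def by (rule card_mono[rotated]) (simp add: S_def)
  also have "\<dots> = card (?d ` S)" using inj by (simp add: card_image)
  also have "\<dots> < card (?d ` verts G)"
  proof (rule psubset_card_mono)
    have "k \<in> ?d ` verts G" "k \<notin> ?d ` S" using xy by (auto simp: S_def)
    then show "?d ` S \<subset> ?d ` verts G" by (auto simp: S_def)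
  qed simp
  finally show ?thesis .
qed

end

theorem theorem3p2:
  fixes G :: "('a, 'b) pre_digraph" and v\<^sub>l :: 'a and n :: nat
  assumes "digraph G"
    and "card (verts G) = n"
    and "v\<^sub>l \<in> verts G"
    and "\<forall>v\<in>verts G. digraph_dist G v v\<^sub>l < \<infinity>"
  shows "pmi_delta G {v\<^sub>l} < n \<longrightarrow> pmi_delta G {v\<^sub>l} > zf_zeta G {v\<^sub>l}"
proof
  assume less: "pmi_delta G {v\<^sub>l} < n"
  interpret digraph G by fact
  note le = card_distances_le_pmi_delta[OF assms(4)]
  \<comment> \<open>Injectivity would give \<open>n\<close> distinct distances, hence
    \<open>n\<close> \<le> \<delta>.\<close>
  then have "\<not> inj_on (\<lambda>v. digraph_dist G v v\<^sub>l) (verts G)"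
    using less assms(2) by (auto dest: card_image)
  then show "pmi_delta G {v\<^sub>l} > zf_zeta G {v\<^sub>l}"
    using zf_zeta_less_card_distances[OF assms(3,4)] le by (blast intro: less_le_trans)
qed

end
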